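(* Let $X_1,\dots,X_n$ be independent random variables with values in $\mathcal{X}\subseteq\mathbb{R}$, where $X_i$ has the exponential family density $p_{X_i}(x;\boldsymbol{\theta}) = h(x)\exp\left(\langle \mathbf{V}_i\boldsymbol{\theta},\mathbf{T}_x\rangle-\phi(\mathbf{V}_i\boldsymbol{\theta})\right)$, with $\boldsymbol{\theta}\in\Theta\subseteq\mathbb{R}^k$ and $\mathbf{V}_i$ a known $d\times k$ matrix, $i\in\{1,\dots,n\}$. Let $B_i=1$ if $X_i\le\tau_i$ and $B_i=-1$ if $X_i>\tau_i$, where $\tau_i$ is a fixed threshold which is an interior point of $\mathcal{X}$. Then the Fisher information matrix of estimating the true parameter vector $\boldsymbol{\theta}_0\in\Theta$ from the censored data $\{B_i\}_{i=1}^n$ is given by $$\mathbf{J}_n=\sum_{i=1}^n \mathbf{V}_i^T\,\mathsf{Cov}\left(\mathbb{E}[\mathbf{T}_{X_i}\mid B_i]\right)\mathbf{V}_i,$$ where expectations and covariances are taken under $\boldsymbol{\theta}_0$.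
   Context: Setting (censored generalized linear model). $h:\mathcal{X}\to(0,+\infty)$ is the base measure; $x\mapsto\mathbf{T}_x\in\mathbb{R}^d$ is the sufficient statistic; $\phi$ is the real-valued log-partition function, i.e. $\phi(\boldsymbol{\eta})=\log\int_{\mathcal{X}}h(x)\exp(\langle\boldsymbol{\eta},\mathbf{T}_x\rangle)\,\mathrm{d}x$; $\boldsymbol{\eta}_{i,\boldsymbol{\theta}}=\mathbf{V}_i\boldsymbol{\theta}\in\mathbb{R}^d$ is the natural parameter of $X_i$. Densities are with respect to an appropriate dominating measure $\mathrm{d}x$ (for discrete distributions, integrals are sums). The probability mass function of $B_i$ is $P_{B_i}(b;\boldsymbol{\theta})=\int_{\mathcal{X}(b)}p_{X_i}(x;\boldsymbol{\theta})\,\mathrm{d}x$ for $b\in\{-1,1\}$, with $\mathcal{X}(1)=\{x\in\mathcal{X}:x\le\tau_i\}$ and $\mathcal{X}(-1)=\{x\in\mathcal{X}:x>\tau_i\}$. The Fisher information matrix of estimating $\boldsymbol{\theta}_0$ from $\{B_i\}_{i=1}^n$ is the $k\times k$ matrix with $(r,s)$ entry $\mathbb{E}\left[\frac{\partial \ell_n}{\partial\theta_r}\frac{\partial \ell_n}{\partial\theta_s}\right]$ evaluated at $\boldsymbol{\theta}=\boldsymbol{\theta}_0$, where $\ell_n(\boldsymbol{\theta})=\sum_{i=1}^n\log P_{B_i}(B_i;\boldsymbol{\theta})$ and the expectation is under $\boldsymbol{\theta}_0$. For a random vector $\mathbf{Y}$, $\mathsf{Cov}(\mathbf{Y})$ is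 its covariance matrix. *)

theory Defs
  imports "HOL-Probability.Probability"
begin

text \<open>The dominating measure \<open>\<nu>\<close> is a measure whose space is the sample space \<open>\<X> \<subseteq> \<real>\<close>
  (Lebesgue measure on \<open>\<X>\<close>, counting measure, ...). Vectors and matrices are indexed by finite types:
  \<open>'d\<close> indexes the sufficient statistic, \<open>'k\<close> the parameter, and a \<open>d \<times> k\<close> matrix has type
  \<open>real^'k^'d\<close>.\<close>

definition natural_params ::
    "real measure \<Rightarrow> (real \<Rightarrow> real) \<Rightarrow> (real \<Rightarrow> real^'d) \<Rightarrow> (real^'d) set" where
  "natural_params \<nu> h T = {\<eta>. integrable \<nu> (\<lambda>x. h x * exp (\<eta> \<bullet> T x))}"

text \<open>\<open>log_partition\<close> and \<open>glm_density\<close> are meaningful only for natural parameters in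
  \<open>natural_params\<close>, which is where the defining integral is finite.\<close>

definition log_partition ::
    "real measure \<Rightarrow> (real \<Rightarrow> real) \<Rightarrow> (real \<Rightarrow> real^'d) \<Rightarrow> real^'d \<Rightarrow> real" where
  "log_partition \<nu> h T \<eta> = ln (\<integral>x. h x * exp (\<eta> \<bullet> T x) \<partial>\<nu>)"

definition glm_density ::
    "real measure \<Rightarrow> (real \<Rightarrow> real) \<Rightarrow> (real \<Rightarrow> real^'d) \<Rightarrow> real^'k^'d \<Rightarrow> real^'k \<Rightarrow> real \<Rightarrow> real" where
  "glm_density \<nu> h T W \<theta> x = h x * exp ((W *v \<theta>) \<bullet> T x - log_partition \<nu> h T (W *v \<theta>))"

definition censor :: "real \<Rightarrow> real \<Rightarrow> int" where
  "censor t x = (if x \<le> t then 1 else -1)"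

definition censor_region :: "real set \<Rightarrow> real \<Rightarrow> int \<Rightarrow> real set" where
  "censor_region \<X> t b = (if b = 1 then {x \<in> \<X>. x \<le> t} else {x \<in> \<X>. x > t})"

definition censored_pmf ::
    "real measure \<Rightarrow> (real \<Rightarrow> real) \<Rightarrow> (real \<Rightarrow> real^'d) \<Rightarrow> real^'k^'d \<Rightarrow> real \<Rightarrow> int \<Rightarrow> real^'k \<Rightarrow> real" where
  "censored_pmf \<nu> h T W t b \<theta> =
    (LINT x:censor_region (space \<nu>) t b|\<nu>. glm_density \<nu> h T W \<theta> x)"

definition censored_loglik ::
    "real measure \<Rightarrow> (real \<Rightarrow> real) \<Rightarrow> (real \<Rightarrow> real^'d) \<Rightarrow> (nat \<Rightarrow> real^'k^'d) \<Rightarrow> (nat \<Rightarrow> real)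
      \<Rightarrow> nat \<Rightarrow> (nat \<Rightarrow> int) \<Rightarrow> real^'k \<Rightarrow> real" where
  "censored_loglik \<nu> h T V \<tau> n b \<theta> = (\<Sum>i=1..n. ln (censored_pmf \<nu> h T (V i) (\<tau> i) (b i) \<theta>))"

definition partial_deriv :: "'k \<Rightarrow> (real^'k \<Rightarrow> real) \<Rightarrow> real^'k \<Rightarrow> real" where
  "partial_deriv r f \<theta> = deriv (\<lambda>u. f (\<theta> + u *\<^sub>R axis r 1)) 0"

text \<open>\<open>L \<omega>\<close> is the log-likelihood function of the data observed at the outcome \<open>\<omega>\<close>, and the
  probability measure \<open>M\<close> is the one belonging to the parameter \<open>\<theta>\<close>.\<close>

definition fisher_information :: "'a measure \<Rightarrow> ('a \<Rightarrow> real^'k \<Rightarrow> real) \<Rightarrow> real^'k \<Rightarrow> real^'k^'k" where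
  "fisher_information M L \<theta> =
    (\<chi> r s. \<integral>\<omega>. partial_deriv r (L \<omega>) \<theta> * partial_deriv s (L \<omega>) \<theta> \<partial>M)"

definition vec_cond_exp :: "'a measure \<Rightarrow> 'a measure \<Rightarrow> ('a \<Rightarrow> real^'d) \<Rightarrow> 'a \<Rightarrow> real^'d" where
  "vec_cond_exp M F Y \<omega> = (\<chi> j. real_cond_exp M F (\<lambda>\<omega>'. Y \<omega>' $ j) \<omega>)"

text \<open>Conditional expectation of \<open>Y\<close> given the discrete random variable \<open>Z\<close>, i.e. given the
  sigma-algebra generated by \<open>Z\<close>.\<close>

definition vec_cond_exp_given :: "'a measure \<Rightarrow> ('a \<Rightarrow> real^'d) \<Rightarrow> ('a \<Rightarrow> int) \<Rightarrow> 'a \<Rightarrow> real^'d" where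
  "vec_cond_exp_given M Y Z = vec_cond_exp M (vimage_algebra (space M) Z (count_space UNIV)) Y"

definition covariance_matrix :: "'a measure \<Rightarrow> ('a \<Rightarrow> real^'d) \<Rightarrow> real^'d^'d" where
  "covariance_matrix M Y =
    (\<chi> r s. \<integral>\<omega>. (Y \<omega> $ r - (\<integral>\<omega>'. Y \<omega>' $ r \<partial>M)) * (Y \<omega> $ s - (\<integral>\<omega>'. Y \<omega>' $ s \<partial>M)) \<partial>M)"

end

theory Submission
  imports Defs
begin

text \<open>Since the true natural parameters are interior, one may differentiate under the integral sign:
  if \<open>F\<^sub>A(\<eta>)\<close> is the integral of \<open>h exp \<langle>\<eta>, T\<rangle>\<close> over \<open>A\<close>, then the
  logarithmic derivative of \<open>F\<^sub>A\<close> in direction \<open>v\<close> is \<open>E[\<langle>v, T\<rangle> | A]\<close>. The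
  log-probability of a censored observation is \<open>ln F\<^sub>A - ln F\<^sub>\<X>\<close>, so its score in the
  coordinate \<open>r\<close> is \<open>E[\<langle>v, T\<rangle> | B] - E\<langle>v, T\<rangle>\<close> with \<open>v\<close> the \<open>r\<close>-th column of
  \<open>V\<close>. These scores are centred and independent over \<open>i\<close>, hence the mixed terms vanish
  and the remaining ones are the entries of the covariance matrices.\<close>

section \<open>Exponential bounds and differentiation under the integral sign\<close>

lemma abs_exp_minus_one_le: "\<bar>exp z - 1\<bar> \<le> \<bar>z\<bar> * exp \<bar>z\<bar>" for z :: real
proof (cases "z \<ge> 0")
  case True
  \<comment> \<open>This is \<open>1 - z \<le> exp (-z)\<close> multiplied by \<open>exp z\<close>;
    the right-hand side equals 1.\<close>
  have "exp z * (1 - z) \<le> exp z * exp (-z)"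
    using exp_ge_add_one_self[of "-z"] by (intro mult_left_mono) auto
  then show ?thesis using True by (simp add: algebra_simps exp_minus)
next
  case False
  have "1 + z \<le> exp z" by (rule exp_ge_add_one_self)
  then have "1 - exp z \<le> - z * 1" by linarith
  also have "\<dots> \<le> - z * exp (-z)" using False by (intro mult_left_mono) auto
  finally show ?thesis using False by (simp add: abs_if)
qed

text \<open>Through this bound, integrability at the two endpoints \<open>e\<close> and
  \<open>- e\<close> passes to every \<open>u\<close> between them.\<close>

lemma exp_mult_le_cosh_bound:
  fixes u e y :: real
  assumes "\<bar>u\<bar> \<le> e"
  shows "exp (u * y) \<le> exp (e * y) + exp (- e * y)"
proof -
  have "u * y \<le> e * \<bar>y\<bar>"
    using mult_right_mono[OF assms abs_ge_zero[of y]] abs_ge_self[of "u * y"] by (simp add: abs_mult)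
  then have "exp (u * y) \<le> exp (e * \<bar>y\<bar>)" by simp
  also have "\<dots> \<le> exp (e * y) + exp (- e * y)" by (cases "y \<ge> 0") auto
  finally show ?thesis .
qed

text \<open>The exponent \<open>e * \<bar>y\<bar>\<close> is split in two halves: one absorbs the
  linear factor \<open>\<bar>y\<bar>\<close>, the other pays for
  \<open>exp \<bar>u * y\<bar>\<close>. This is why \<open>u\<close> only ranges up to
  \<open>e / 2\<close>. The bound does not depend on \<open>u\<close>, as dominated convergence
  requires.\<close>

lemma abs_mult_exp_le_cosh_bound:
  fixes u e y :: real
  assumes "0 < e" "\<bar>u\<bar> \<le> e / 2"
  shows "\<bar>y\<bar> * exp \<bar>u * y\<bar> \<le> 2 / e * (exp (e * y) + exp (- e * y))"
proof -
  have "e / 2 * \<bar>y\<bar> \<le> exp (e / 2 * \<bar>y\<bar>)"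
    using exp_ge_add_one_self[of "e / 2 * \<bar>y\<bar>"] by linarith
  then have "\<bar>y\<bar> \<le> 2 / e * exp (e / 2 * \<bar>y\<bar>)"
    using assms by (simp add: field_simps)
  moreover have "exp \<bar>u * y\<bar> \<le> exp (e / 2 * \<bar>y\<bar>)"
    using mult_right_mono[OF assms(2) abs_ge_zero[of y]] by (simp add: abs_mult)
  ultimately have "\<bar>y\<bar> * exp \<bar>u * y\<bar> \<le> (2 / e * exp (e / 2 * \<bar>y\<bar>)) * exp (e / 2 * \<bar>y\<bar>)"
    using assms by (intro mult_mono) auto
  also have "\<dots> = 2 / e * exp (e * \<bar>y\<bar>)"
    by (simp flip: exp_add)
  also have "\<dots> \<le> 2 / e * (exp (e * y) + exp (- e * y))"
    using assms by (intro mult_left_mono) (cases "y \<ge> 0"; auto)+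
  finally show ?thesis .
qed

text \<open>Difference quotients of \<open>exp (u * Y x)\<close> at 0 are at most
  \<open>\<bar>Y x\<bar> * exp \<bar>u * Y x\<bar>\<close> in absolute value, so after
  multiplication by \<open>f\<close> they are dominated by one integrable function \<open>w\<close>,
  and dominated convergence gives the derivative.\<close>

lemma
  fixes f Y :: "'a \<Rightarrow> real"
  assumes [measurable]: "f \<in> borel_measurable N" "Y \<in> borel_measurable N"
    and "0 < e"
    and int_pos: "integrable N (\<lambda>x. f x * exp (e * Y x))"
    and int_neg: "integrable N (\<lambda>x. f x * exp (- e * Y x))"
  shows integrable_mult_of_exp_moments: "integrable N (\<lambda>x. f x * Y x)"
    and DERIV_exp_moment:
      "((\<lambda>u. \<integral>x. f x * exp (u * Y x) \<partial>N) has_real_derivative (\<integral>x. f x * Y x \<partial>N)) (at 0)"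
proof -
  define w where "w x = \<bar>f x\<bar> * (2 / e * (exp (e * Y x) + exp (- e * Y x)))" for x
  have w: "integrable N w"
  proof -
    have "w = (\<lambda>x. 2 / e * (\<bar>f x * exp (e * Y x)\<bar> + \<bar>f x * exp (- e * Y x)\<bar>))"
      by (auto simp: w_def abs_mult algebra_simps)
    then show ?thesis using int_pos int_neg by simp
  qed
  have bound: "\<bar>f x\<bar> * (\<bar>Y x\<bar> * exp \<bar>u * Y x\<bar>) \<le> w x" if "\<bar>u\<bar> \<le> e / 2" for u x
    unfolding w_def using abs_mult_exp_le_cosh_bound[OF \<open>0 < e\<close> that] by (intro mult_left_mono) auto
  \<comment> \<open>The case \<open>u = 0\<close> of \<open>bound\<close> says that
    \<open>\<bar>f x * Y x\<bar> \<le> w x\<close>.\<close>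
  show "integrable N (\<lambda>x. f x * Y x)"
    using w by (rule Bochner_Integration.integrable_bound)
      (use bound[of 0] \<open>0 < e\<close> in \<open>auto simp: abs_mult intro!: AE_I2 order.trans[OF _ abs_ge_self]\<close>)
  have int: "integrable N (\<lambda>x. f x * exp (u * Y x))" if "\<bar>u\<bar> \<le> e" for u
  proof (rule Bochner_Integration.integrable_bound)
    show "integrable N (\<lambda>x. \<bar>f x * exp (e * Y x)\<bar> + \<bar>f x * exp (- e * Y x)\<bar>)"
      using int_pos int_neg by simp
    show "AE x in N. norm (f x * exp (u * Y x))
        \<le> norm (\<bar>f x * exp (e * Y x)\<bar> + \<bar>f x * exp (- e * Y x)\<bar>)"
      using mult_left_mono[OF exp_mult_le_cosh_bound[OF that] abs_ge_zero]
      by (intro AE_I2) (simp add: abs_mult distrib_left)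
  qed simp
  let ?q = "\<lambda>u x. f x * ((exp (u * Y x) - 1) / u)"
  \<comment> \<open>The limit is first taken within an interval, so that every term of an
    approximating sequence, and not only its tail, satisfies the domination by \<open>w\<close>.
    Since 0 is interior to the interval, this is the ordinary limit.\<close>
  have "((\<lambda>u. \<integral>x. ?q u x \<partial>N) \<longlongrightarrow> (\<integral>x. f x * Y x \<partial>N)) (at 0 within {- (e / 2)..e / 2})"
    unfolding tendsto_at_iff_sequentially comp_def
  proof (intro allI impI)
    fix s :: "nat \<Rightarrow> real"
    assume s: "\<forall>i. s i \<in> {- (e / 2)..e / 2} - {0}" "s \<longlonglongrightarrow> 0"
    show "(\<lambda>i. \<integral>x. ?q (s i) x \<partial>N) \<longlonglongrightarrow> (\<integral>x. f x * Y x \<partial>N)"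
    proof (rule integral_dominated_convergence[OF _ _ w])
      show "AE x in N. (\<lambda>i. ?q (s i) x) \<longlonglongrightarrow> f x * Y x"
      proof (rule AE_I2)
        fix x
        have "((\<lambda>u. exp (u * Y x)) has_real_derivative Y x) (at 0)"
          by (auto intro!: derivative_eq_intros)
        then have "((\<lambda>u. (exp (u * Y x) - 1) / u) \<longlongrightarrow> Y x) (at 0)"
          by (simp add: has_field_derivative_iff)
        moreover have "filterlim s (at 0) sequentially"
          using s by (auto simp: filterlim_at)
        ultimately show "(\<lambda>i. ?q (s i) x) \<longlonglongrightarrow> f x * Y x"
          by (intro tendsto_mult tendsto_const) (rule filterlim_compose)
      qed
      show "AE x in N. norm (?q (s i) x) \<le> w x" for i
      proof (rule AE_I2)
        fix x
        have si: "s i \<noteq> 0" "\<bar>s i\<bar> \<le> e / 2" using s(1)[rule_format, of i] by auto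
        have "\<bar>(exp (s i * Y x) - 1) / s i\<bar> \<le> \<bar>Y x\<bar> * exp \<bar>s i * Y x\<bar>"
          using abs_exp_minus_one_le[of "s i * Y x"] si(1) by (simp add: field_simps abs_mult)
        then have "norm (?q (s i) x) \<le> \<bar>f x\<bar> * (\<bar>Y x\<bar> * exp \<bar>s i * Y x\<bar>)"
          unfolding real_norm_def abs_mult[of "f x"] by (intro mult_left_mono) auto
        then show "norm (?q (s i) x) \<le> w x" using bound[OF si(2)] by (rule order.trans)
      qed
    qed simp_all
  qed
  moreover have "at 0 within {- (e / 2)..e / 2} = at 0"
    using \<open>0 < e\<close> by (intro at_within_Icc_at) auto
  ultimately have "((\<lambda>u. \<integral>x. ?q u x \<partial>N) \<longlongrightarrow> (\<integral>x. f x * Y x \<partial>N)) (at 0)"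
    by simp
  moreover have "\<forall>\<^sub>F u in at 0. (\<integral>x. ?q u x \<partial>N)
      = ((\<integral>x. f x * exp (u * Y x) \<partial>N) - (\<integral>x. f x * exp (0 * Y x) \<partial>N)) / (u - 0)"
  proof -
    have "\<forall>\<^sub>F u in at (0::real). \<bar>u\<bar> < e"
      using eventually_at_in_open'[of "{-e<..<e}" 0] \<open>0 < e\<close> by (auto elim: eventually_mono)
    then show ?thesis
    proof eventually_elim
      case (elim u)
      have "(\<integral>x. f x * exp (u * Y x) \<partial>N) - (\<integral>x. f x * exp (0 * Y x) \<partial>N)
          = (\<integral>x. f x * exp (u * Y x) - f x * exp (0 * Y x) \<partial>N)"
        using int[of u] int[of 0] elim \<open>0 < e\<close> by (intro Bochner_Integration.integral_diff[symmetric]) auto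
      then show ?case by (simp flip: integral_divide_zero add: diff_divide_distrib right_diff_distrib)
    qed
  qed
  ultimately show "((\<lambda>u. \<integral>x. f x * exp (u * Y x) \<partial>N) has_real_derivative (\<integral>x. f x * Y x \<partial>N)) (at 0)"
    unfolding has_field_derivative_iff by (rule Lim_transform_eventually)
qed

section \<open>Conditional expectation given a variable with finitely many values\<close>

lemma integrable_indicator_mult:
  fixes g :: "'a \<Rightarrow> real"
  shows "A \<in> sets M \<Longrightarrow> integrable M g \<Longrightarrow> integrable M (\<lambda>\<omega>. indicator A \<omega> * g \<omega>)"
  using integrable_mult_indicator[of A M g] by simp

text \<open>The elementary conditional expectation of \<open>Y\<close> given \<open>Z = z\<close>.
  As a function of the value \<open>z\<close> it can be used both for a fixed censored value and,
  composed with \<open>Z\<close>, as a random variable. On a null atom division by zero makes it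
  0.\<close>

definition atom_mean :: "'a measure \<Rightarrow> ('a \<Rightarrow> 'b) \<Rightarrow> ('a \<Rightarrow> real) \<Rightarrow> 'b \<Rightarrow> real" where
  "atom_mean M Z Y z =
    (\<integral>\<omega>. indicator (Z -` {z} \<inter> space M) \<omega> * Y \<omega> \<partial>M) / measure M (Z -` {z} \<inter> space M)"

lemma atom_mean_sum:
  assumes [measurable]: "Z \<in> measurable M (count_space UNIV)"
    and "\<And>a. a \<in> A \<Longrightarrow> integrable M (Y a)"
  shows "atom_mean M Z (\<lambda>\<omega>. \<Sum>a\<in>A. c a * Y a \<omega>) z = (\<Sum>a\<in>A. c a * atom_mean M Z (Y a) z)"
proof -
  have "(\<integral>\<omega>. indicator (Z -` {z} \<inter> space M) \<omega> * (\<Sum>a\<in>A. c a * Y a \<omega>) \<partial>M)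
      = (\<integral>\<omega>. (\<Sum>a\<in>A. c a * (indicator (Z -` {z} \<inter> space M) \<omega> * Y a \<omega>)) \<partial>M)"
    by (simp add: sum_distrib_left mult.left_commute)
  also have "\<dots> = (\<Sum>a\<in>A. c a * (\<integral>\<omega>. indicator (Z -` {z} \<inter> space M) \<omega> * Y a \<omega> \<partial>M))"
    using assms(2) by (subst Bochner_Integration.integral_sum)
      (auto intro!: integrable_mult_right integrable_indicator_mult)
  finally show ?thesis
    by (simp add: atom_mean_def sum_divide_distrib)
qed

context prob_space
begin

text \<open>Only finitely many atoms can be null, so their union is null as well. The
  log-probability of an observed value is thus almost surely taken at an atom of positive
  probability.\<close>

lemma AE_atom_pos:
  assumes [measurable]: "Z \<in> measurable M (count_space UNIV)"
    and "finite S" "Z ` space M \<subseteq> S"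
  shows "AE \<omega> in M. 0 < prob (Z -` {Z \<omega>} \<inter> space M)"
proof -
  have "AE \<omega> in M. prob (Z -` {z} \<inter> space M) = 0 \<longrightarrow> Z \<omega> \<noteq> z" for z
  proof (cases "prob (Z -` {z} \<inter> space M) = 0")
    case True
    then have "Z -` {z} \<inter> space M \<in> null_sets M"
      by (auto simp: null_sets_def emeasure_eq_measure)
    then show ?thesis by (rule AE_I') auto
  qed simp
  then have "AE \<omega> in M. \<forall>z\<in>S. prob (Z -` {z} \<inter> space M) = 0 \<longrightarrow> Z \<omega> \<noteq> z"
    using \<open>finite S\<close> by (intro AE_finite_allI)
  then show ?thesis
  proof (rule AE_mp, intro AE_I2 impI)
    fix \<omega> assume "\<omega> \<in> space M" "\<forall>z\<in>S. prob (Z -` {z} \<inter> space M) = 0 \<longrightarrow> Z \<omega> \<noteq> z"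
    then have "prob (Z -` {Z \<omega>} \<inter> space M) \<noteq> 0" using assms(3) by blast
    then show "0 < prob (Z -` {Z \<omega>} \<inter> space M)"
      using measure_nonneg[of M "Z -` {Z \<omega>} \<inter> space M"] by linarith
  qed
qed

lemma integrable_finite_range:
  fixes f :: "'b \<Rightarrow> real"
  assumes [measurable]: "Z \<in> measurable M (count_space UNIV)"
    and "finite S" "Z ` space M \<subseteq> S"
  shows "integrable M (\<lambda>\<omega>. f (Z \<omega>))"
proof (rule integrable_const_bound)
  show "AE \<omega> in M. norm (f (Z \<omega>)) \<le> (\<Sum>z\<in>S. \<bar>f z\<bar>)"
    using assms(2,3) by (intro AE_I2) (auto intro!: member_le_sum)
  show "(\<lambda>\<omega>. f (Z \<omega>)) \<in> borel_measurable M"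
    using measurable_compose[OF assms(1), of f borel] by simp
qed

text \<open>Every event generated by \<open>Z\<close> is a finite disjoint union of atoms, so
  integrals over such events need to be compared on atoms only.\<close>

lemma integral_vimage_eq_sum_atoms:
  fixes g :: "'a \<Rightarrow> real"
  assumes [measurable]: "Z \<in> measurable M (count_space UNIV)"
    and "finite S" "Z ` space M \<subseteq> S" and "integrable M g"
  shows "(\<integral>\<omega>. indicator (Z -` C \<inter> space M) \<omega> * g \<omega> \<partial>M)
    = (\<Sum>z\<in>S \<inter> C. \<integral>\<omega>. indicator (Z -` {z} \<inter> space M) \<omega> * g \<omega> \<partial>M)"
proof -
  have "indicator (Z -` C \<inter> space M) \<omega> * g \<omega>
      = (\<Sum>z\<in>S \<inter> C. indicator (Z -` {z} \<inter> space M) \<omega> * g \<omega>)" if "\<omega> \<in> space M" for \<omega>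
  proof -
    have "(\<Sum>z\<in>S \<inter> C. indicator (Z -` {z} \<inter> space M) \<omega> * g \<omega>)
        = (\<Sum>z\<in>S \<inter> C. if z = Z \<omega> then g \<omega> else 0)"
      using that by (intro sum.cong) (auto simp: indicator_def)
    then show ?thesis using that assms(2,3) by (auto simp: indicator_def)
  qed
  then have "(\<integral>\<omega>. indicator (Z -` C \<inter> space M) \<omega> * g \<omega> \<partial>M)
      = (\<integral>\<omega>. (\<Sum>z\<in>S \<inter> C. indicator (Z -` {z} \<inter> space M) \<omega> * g \<omega>) \<partial>M)"
    by (intro Bochner_Integration.integral_cong) auto
  also have "\<dots> = (\<Sum>z\<in>S \<inter> C. \<integral>\<omega>. indicator (Z -` {z} \<inter> space M) \<omega> * g \<omega> \<partial>M)"
    using assms(4)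
    by (intro Bochner_Integration.integral_sum)
      (auto intro!: integrable_indicator_mult)
  finally show ?thesis .
qed

text \<open>The atom mean, composed with \<open>Z\<close>, is measurable for the sigma-algebra of
  \<open>Z\<close> and has the same integral as \<open>Y\<close> over each atom, hence over each
  event of that sigma-algebra. This characterizes the conditional expectation; the whole space as
  event gives the law of total expectation.\<close>

lemma
  fixes Y :: "'a \<Rightarrow> real"
  assumes Z [measurable]: "Z \<in> measurable M (count_space UNIV)"
    and S: "finite S" "Z ` space M \<subseteq> S" and Y: "integrable M Y"
  shows real_cond_exp_eq_atom_mean: "AE \<omega> in M.
      real_cond_exp M (vimage_algebra (space M) Z (count_space UNIV)) Y \<omega> = atom_mean M Z Y (Z \<omega>)"
    and expectation_atom_mean: "(\<integral>\<omega>. atom_mean M Z Y (Z \<omega>) \<partial>M) = (\<integral>\<omega>. Y \<omega> \<partial>M)"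
proof -
  define F where "F = vimage_algebra (space M) Z (count_space UNIV)"
  have space_F: "space F = space M"
    by (simp add: F_def)
  have sets_F: "sets F = {Z -` C \<inter> space M | C. C \<in> UNIV}"
    unfolding F_def by (subst sets_vimage_algebra2) auto
  have int: "integrable M (\<lambda>\<omega>. atom_mean M Z Y (Z \<omega>))"
    by (rule integrable_finite_range[OF Z S])
  have atom: "(\<integral>\<omega>. indicator (Z -` {z} \<inter> space M) \<omega> * atom_mean M Z Y (Z \<omega>) \<partial>M)
      = (\<integral>\<omega>. indicator (Z -` {z} \<inter> space M) \<omega> * Y \<omega> \<partial>M)" for z
  proof -
    let ?A = "Z -` {z} \<inter> space M"
    have "(\<integral>\<omega>. indicator ?A \<omega> * atom_mean M Z Y (Z \<omega>) \<partial>M)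
        = (\<integral>\<omega>. indicator ?A \<omega> * atom_mean M Z Y z \<partial>M)"
      by (intro Bochner_Integration.integral_cong) (auto simp: indicator_def)
    also have "\<dots> = prob ?A * atom_mean M Z Y z"
      by simp
    also have "\<dots> = (\<integral>\<omega>. indicator ?A \<omega> * Y \<omega> \<partial>M)"
    \<comment> \<open>On a null atom the default value of \<open>atom_mean\<close> is harmless: both
      sides are 0.\<close>
    proof (cases "prob ?A = 0")
      case True
      then have "?A \<in> null_sets M" by (auto simp: null_sets_def emeasure_eq_measure)
      then have "AE \<omega> in M. indicator ?A \<omega> * Y \<omega> = 0" by (rule AE_I') (auto simp: indicator_def)
      then have "(\<integral>\<omega>. indicator ?A \<omega> * Y \<omega> \<partial>M) = 0" by (rule integral_eq_zero_AE)
      then show ?thesis using True by simp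
    qed (simp add: atom_mean_def)
    finally show ?thesis .
  qed
  have eq: "(\<integral>\<omega>. indicator (Z -` C \<inter> space M) \<omega> * Y \<omega> \<partial>M)
      = (\<integral>\<omega>. indicator (Z -` C \<inter> space M) \<omega> * atom_mean M Z Y (Z \<omega>) \<partial>M)" for C
    unfolding integral_vimage_eq_sum_atoms[OF Z S Y, of C] integral_vimage_eq_sum_atoms[OF Z S int, of C] atom ..
  have "subalgebra M F"
    by (auto simp: subalgebra_def sets_F space_F)
  then interpret finite_measure_subalgebra M F
    by unfold_locales
  have "AE \<omega> in M. real_cond_exp M F Y \<omega> = atom_mean M Z Y (Z \<omega>)"
  proof (rule real_cond_exp_charact[OF _ Y int])
    show "(LINT \<omega>:A|M. Y \<omega>) = (LINT \<omega>:A|M. atom_mean M Z Y (Z \<omega>))" if "A \<in> sets F" for A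
      using that eq by (auto simp: sets_F set_lebesgue_integral_def)
    have "Z \<in> measurable F (count_space UNIV)"
      unfolding F_def by (rule measurable_vimage_algebra1) auto
    then show "(\<lambda>\<omega>. atom_mean M Z Y (Z \<omega>)) \<in> borel_measurable F"
      by (rule measurable_compose) simp
  qed
  then show "AE \<omega> in M.
      real_cond_exp M (vimage_algebra (space M) Z (count_space UNIV)) Y \<omega> = atom_mean M Z Y (Z \<omega>)"
    by (simp add: F_def)
  have "(\<integral>\<omega>. indicator (Z -` UNIV \<inter> space M) \<omega> * f \<omega> \<partial>M) = (\<integral>\<omega>. f \<omega> \<partial>M)" for f :: "'a \<Rightarrow> real"
    by (intro Bochner_Integration.integral_cong) auto
  then show "(\<integral>\<omega>. atom_mean M Z Y (Z \<omega>) \<partial>M) = (\<integral>\<omega>. Y \<omega> \<partial>M)"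
    using eq[of UNIV] by simp
qed

text \<open>For \<open>i \<noteq> j\<close> independence factors the expectation of the mixed term,
  and the centred factor \<open>f i\<close> makes it 0. Only the diagonal of the double sum
  survives.\<close>

lemma expectation_sum_mult_sum_indep:
  fixes f g :: "'i \<Rightarrow> 'b \<Rightarrow> real"
  assumes "finite I" and indep: "indep_vars N X I"
    and meas: "\<And>i. i \<in> I \<Longrightarrow> f i \<in> borel_measurable (N i)" "\<And>i. i \<in> I \<Longrightarrow> g i \<in> borel_measurable (N i)"
    and f: "\<And>i. i \<in> I \<Longrightarrow> integrable M (\<lambda>\<omega>. f i (X i \<omega>))"
      "\<And>i. i \<in> I \<Longrightarrow> (\<integral>\<omega>. f i (X i \<omega>) \<partial>M) = 0"
    and g: "\<And>i. i \<in> I \<Longrightarrow> integrable M (\<lambda>\<omega>. g i (X i \<omega>))"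
    and fg: "\<And>i. i \<in> I \<Longrightarrow> integrable M (\<lambda>\<omega>. f i (X i \<omega>) * g i (X i \<omega>))"
  shows "(\<integral>\<omega>. (\<Sum>i\<in>I. f i (X i \<omega>)) * (\<Sum>i\<in>I. g i (X i \<omega>)) \<partial>M)
    = (\<Sum>i\<in>I. \<integral>\<omega>. f i (X i \<omega>) * g i (X i \<omega>) \<partial>M)"
proof -
  have cross: "integrable M (\<lambda>\<omega>. f i (X i \<omega>) * g j (X j \<omega>)) \<and>
      (\<integral>\<omega>. f i (X i \<omega>) * g j (X j \<omega>) \<partial>M) = 0" if ij: "i \<in> I" "j \<in> I" "i \<noteq> j" for i j
  proof -
    \<comment> \<open>The two different functions are packed into one family over
      \<open>{i, j}\<close>, so that the product formula for an independent family applies.\<close>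
    define W where "W k = (if k = i then f i else g j)" for k
    have "indep_vars N X {i, j}"
      using indep ij by (rule_tac indep_vars_subset) auto
    then have ind: "indep_vars (\<lambda>_. borel) (\<lambda>k \<omega>. W k (X k \<omega>)) {i, j}"
      by (rule indep_vars_compose2) (use ij meas in \<open>auto simp: W_def\<close>)
    have int: "integrable M (\<lambda>\<omega>. W k (X k \<omega>))" if "k \<in> {i, j}" for k
      using that ij f(1) g by (auto simp: W_def)
    show ?thesis
      using indep_vars_lebesgue_integral[OF _ ind int] indep_vars_integrable[OF _ ind int] ij f(2)[OF ij(1)]
      by (simp add: W_def)
  qed
  have int: "integrable M (\<lambda>\<omega>. f i (X i \<omega>) * g j (X j \<omega>))" if "i \<in> I" "j \<in> I" for i j
    using cross[OF that] fg that by (cases "i = j") auto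
  have "(\<integral>\<omega>. (\<Sum>i\<in>I. f i (X i \<omega>)) * (\<Sum>i\<in>I. g i (X i \<omega>)) \<partial>M)
      = (\<Sum>i\<in>I. \<Sum>j\<in>I. \<integral>\<omega>. f i (X i \<omega>) * g j (X j \<omega>) \<partial>M)"
    unfolding sum_product using int by (subst Bochner_Integration.integral_sum; simp)+
  also have "\<dots> = (\<Sum>i\<in>I. \<Sum>j\<in>I. if j = i then \<integral>\<omega>. f i (X i \<omega>) * g i (X i \<omega>) \<partial>M else 0)"
    using cross by (intro sum.cong) auto
  finally show ?thesis using \<open>finite I\<close> by simp
qed

end

section \<open>The score of a single censored observation\<close>

lemma censor_eq_iff: "b \<in> {1, -1} \<Longrightarrow> x \<in> A \<Longrightarrow> censor t x = b \<longleftrightarrow> x \<in> censor_region A t b"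
  by (auto simp: censor_def censor_region_def)

lemma censor_in: "censor t x \<in> {1, -1}"
  by (simp add: censor_def)

lemma censor_measurable [measurable]: "censor t \<in> measurable borel (count_space UNIV)"
  unfolding censor_def by measurable

text \<open>The closed form of the \<open>r\<close>-th partial derivative of the log-probability of
  \<open>b\<close>: moving the parameter along \<open>axis r 1\<close> moves the natural parameter
  along \<open>column r W\<close>.\<close>

definition censored_score ::
    "'a measure \<Rightarrow> ('a \<Rightarrow> real) \<Rightarrow> (real \<Rightarrow> real^'d) \<Rightarrow> real^'k^'d \<Rightarrow> real \<Rightarrow> 'k \<Rightarrow> int \<Rightarrow> real" where
  "censored_score M X T W t r b =
    atom_mean M (\<lambda>\<omega>. censor t (X \<omega>)) (\<lambda>\<omega>. column r W \<bullet> T (X \<omega>)) b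
      - (\<integral>\<omega>. column r W \<bullet> T (X \<omega>) \<partial>M)"

text \<open>The model for one index \<open>i\<close>, with the index dropped. The Borel structure of
  the sample space enters through \<open>id_measurable\<close>, which makes the censoring regions
  measurable.\<close>

locale glm_observation = prob_space M
  for M :: "'a measure" and X :: "'a \<Rightarrow> real" and \<nu> :: "real measure" and h :: "real \<Rightarrow> real"
    and T :: "real \<Rightarrow> real^'d" and W :: "real^'k^'d" and \<theta>0 :: "real^'k" +
  assumes X_borel [measurable]: "X \<in> borel_measurable M"
    and id_measurable: "(\<lambda>x. x) \<in> measurable \<nu> borel"
    and h_measurable [measurable]: "h \<in> borel_measurable \<nu>"
    and h_pos: "\<And>x. x \<in> space \<nu> \<Longrightarrow> 0 < h x"
    and T_measurable [measurable]: "T \<in> borel_measurable \<nu>"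
    and interior: "W *v \<theta>0 \<in> interior (natural_params \<nu> h T)"
    and X_distributed: "distributed M \<nu> X (\<lambda>x. ennreal (glm_density \<nu> h T W \<theta>0 x))"
begin

definition normalizer :: real where
  "normalizer = (\<integral>x. h x * exp ((W *v \<theta>0) \<bullet> T x) \<partial>\<nu>)"

lemma X_measurable [measurable]: "X \<in> measurable M \<nu>"
  using X_distributed by (rule distributed_measurable)

lemma glm_density_nonneg: "x \<in> space \<nu> \<Longrightarrow> 0 \<le> glm_density \<nu> h T W \<theta> x"
  using h_pos[of x] by (simp add: glm_density_def)

text \<open>The density is a constant multiple of the integrand of \<open>normalizer\<close>,
  whatever value \<open>ln\<close> takes. Were the normalizer 0, the density would integrate to 0
  instead of 1.\<close>

lemma normalizer_pos: "0 < normalizer"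
proof -
  have "normalizer \<noteq> 0"
  proof
    assume *: "normalizer = 0"
    have "(\<integral>x. glm_density \<nu> h T W \<theta>0 x * 1 \<partial>\<nu>) = (\<integral>\<omega>. 1 \<partial>M)"
      by (rule distributed_integral[OF X_distributed]) (auto simp: glm_density_nonneg)
    then have "(\<integral>x. glm_density \<nu> h T W \<theta>0 x \<partial>\<nu>) = 1"
      by (simp add: prob_space)
    moreover have "glm_density \<nu> h T W \<theta>0 x
        = h x * exp ((W *v \<theta>0) \<bullet> T x) * exp (- log_partition \<nu> h T (W *v \<theta>0))" for x
      by (simp add: glm_density_def exp_diff exp_minus field_simps)
    ultimately show False
      using * by (simp add: normalizer_def)
  qed
  moreover have "0 \<le> normalizer"
    unfolding normalizer_def by (intro integral_nonneg_AE AE_I2) (use h_pos in \<open>auto intro: less_imp_le\<close>)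
  ultimately show ?thesis by simp
qed

lemma glm_density_eq: "glm_density \<nu> h T W \<theta>0 x = h x * exp ((W *v \<theta>0) \<bullet> T x) / normalizer"
  using normalizer_pos by (simp add: glm_density_def log_partition_def exp_diff flip: normalizer_def)

text \<open>Translates integrals of the unnormalized density against \<open>\<nu>\<close> into
  expectations under \<open>M\<close>.\<close>

lemma
  assumes [measurable]: "g \<in> borel_measurable \<nu>"
  shows integral_weight: "(\<integral>x. h x * exp ((W *v \<theta>0) \<bullet> T x) * g x \<partial>\<nu>) = normalizer * (\<integral>\<omega>. g (X \<omega>) \<partial>M)"
    and integrable_weight: "integrable \<nu> (\<lambda>x. h x * exp ((W *v \<theta>0) \<bullet> T x) * g x) \<longleftrightarrow> integrable M (\<lambda>\<omega>. g (X \<omega>))"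
proof -
  have eq: "h x * exp ((W *v \<theta>0) \<bullet> T x) * g x = normalizer * (glm_density \<nu> h T W \<theta>0 x * g x)" for x
    using normalizer_pos by (simp add: glm_density_eq)
  show "(\<integral>x. h x * exp ((W *v \<theta>0) \<bullet> T x) * g x \<partial>\<nu>) = normalizer * (\<integral>\<omega>. g (X \<omega>) \<partial>M)"
    using distributed_integral[OF X_distributed assms glm_density_nonneg] by (simp add: eq)
  show "integrable \<nu> (\<lambda>x. h x * exp ((W *v \<theta>0) \<bullet> T x) * g x) \<longleftrightarrow> integrable M (\<lambda>\<omega>. g (X \<omega>))"
    using distributed_integrable[OF X_distributed assms glm_density_nonneg] normalizer_pos by (simp add: eq)
qed

lemma natural_direction:
  obtains e where "0 < e" "\<And>u. \<bar>u\<bar> \<le> e \<Longrightarrow> W *v \<theta>0 + u *\<^sub>R v \<in> natural_params \<nu> h T"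
proof -
  have "isCont (\<lambda>u. W *v \<theta>0 + u *\<^sub>R v) 0" by (intro continuous_intros)
  then have "((\<lambda>u. W *v \<theta>0 + u *\<^sub>R v) \<longlongrightarrow> W *v \<theta>0) (nhds 0)"
    using tendsto_at_iff_tendsto_nhds[of "\<lambda>u. W *v \<theta>0 + u *\<^sub>R v" 0] by (simp add: isCont_def)
  then have "\<forall>\<^sub>F u in nhds 0. W *v \<theta>0 + u *\<^sub>R v \<in> interior (natural_params \<nu> h T)"
    using topological_tendstoD[OF _ open_interior interior] by blast
  then obtain d where "0 < d" "\<And>u. \<bar>u\<bar> < d \<Longrightarrow> W *v \<theta>0 + u *\<^sub>R v \<in> interior (natural_params \<nu> h T)"
    by (auto simp: eventually_nhds_metric dist_real_def)
  \<comment> \<open>Halving \<open>d\<close> turns the open range of \<open>u\<close> into a closed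
    one that includes both endpoints.\<close>
  then show thesis
    using interior_subset[of "natural_params \<nu> h T"] by (intro that[of "d / 2"]) auto
qed

text \<open>\<open>DERIV_exp_moment\<close> is applied to the unnormalized density restricted to a
  region, with \<open>v \<bullet> T x\<close> as exponent. The exponential moments at
  \<open>e\<close> and \<open>- e\<close> are finite because the true natural parameter can be moved
  both ways along \<open>v\<close>. Integrability is the case of the whole space.\<close>

lemma
  assumes [measurable]: "A \<in> sets \<nu>"
  shows integrable_direction: "integrable M (\<lambda>\<omega>. v \<bullet> T (X \<omega>))"
    and DERIV_region: "((\<lambda>u. \<integral>x. indicator A x * (h x * exp ((W *v \<theta>0 + u *\<^sub>R v) \<bullet> T x)) \<partial>\<nu>)
      has_real_derivative normalizer * (\<integral>\<omega>. indicator A (X \<omega>) * (v \<bullet> T (X \<omega>)) \<partial>M)) (at 0)"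
proof -
  obtain e where e: "0 < e" "\<And>u. \<bar>u\<bar> \<le> e \<Longrightarrow> W *v \<theta>0 + u *\<^sub>R v \<in> natural_params \<nu> h T"
    using natural_direction[of v] by blast
  define f where "f B x = indicator B x * (h x * exp ((W *v \<theta>0) \<bullet> T x))" for B x
  have [measurable]: "f B \<in> borel_measurable \<nu>" if "B \<in> sets \<nu>" for B
    unfolding f_def using that by measurable
  have split: "f B x * exp (u * (v \<bullet> T x)) = indicator B x * (h x * exp ((W *v \<theta>0 + u *\<^sub>R v) \<bullet> T x))"
    for B u x by (simp add: f_def inner_add_left exp_add)
  have int: "integrable \<nu> (\<lambda>x. f B x * exp (u * (v \<bullet> T x)))" if "B \<in> sets \<nu>" "\<bar>u\<bar> \<le> e" for B u
    unfolding split using integrable_mult_indicator[OF that(1), of "\<lambda>x. h x * exp ((W *v \<theta>0 + u *\<^sub>R v) \<bullet> T x)"]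
      e(2)[OF that(2)] by (simp add: natural_params_def)
  have f_eq: "f B x * (v \<bullet> T x) = h x * exp ((W *v \<theta>0) \<bullet> T x) * (indicator B x * (v \<bullet> T x))" for B x
    by (simp add: f_def)
  have "integrable \<nu> (\<lambda>x. f (space \<nu>) x * (v \<bullet> T x))"
    by (rule integrable_mult_of_exp_moments[of _ _ _ e]) (use e(1) int[OF sets.top, of e] int[OF sets.top, of "- e"] in auto)
  then have "integrable M (\<lambda>\<omega>. indicator (space \<nu>) (X \<omega>) * (v \<bullet> T (X \<omega>)))"
    unfolding f_eq by (subst (asm) integrable_weight) auto
  moreover have "indicator (space \<nu>) (X \<omega>) = (1::real)" if "\<omega> \<in> space M" for \<omega>
    using measurable_space[OF X_measurable that] by simp
  ultimately show "integrable M (\<lambda>\<omega>. v \<bullet> T (X \<omega>))"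
    by (simp cong: Bochner_Integration.integrable_cong)
  have "((\<lambda>u. \<integral>x. f A x * exp (u * (v \<bullet> T x)) \<partial>\<nu>) has_real_derivative (\<integral>x. f A x * (v \<bullet> T x) \<partial>\<nu>)) (at 0)"
    by (rule DERIV_exp_moment[of _ _ _ e]) (use e(1) int[OF assms, of e] int[OF assms, of "- e"] in auto)
  then show "((\<lambda>u. \<integral>x. indicator A x * (h x * exp ((W *v \<theta>0 + u *\<^sub>R v) \<bullet> T x)) \<partial>\<nu>)
      has_real_derivative normalizer * (\<integral>\<omega>. indicator A (X \<omega>) * (v \<bullet> T (X \<omega>)) \<partial>M)) (at 0)"
    unfolding f_eq split by (subst (asm) integral_weight) auto
qed

text \<open>The vanishing term \<open>0 *\<^sub>R v\<close> is kept so that the left-hand side is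
  literally the function of \<open>DERIV_region\<close> at \<open>u = 0\<close>.\<close>

lemma region_at_zero:
  assumes [measurable]: "A \<in> sets \<nu>"
  shows "(\<integral>x. indicator A x * (h x * exp ((W *v \<theta>0 + 0 *\<^sub>R v) \<bullet> T x)) \<partial>\<nu>) = normalizer * prob (X -` A \<inter> space M)"
proof -
  have "(\<integral>x. indicator A x * (h x * exp ((W *v \<theta>0 + 0 *\<^sub>R v) \<bullet> T x)) \<partial>\<nu>)
      = (\<integral>x. h x * exp ((W *v \<theta>0) \<bullet> T x) * indicator A x \<partial>\<nu>)"
    by (simp add: mult.commute)
  also have "\<dots> = normalizer * (\<integral>\<omega>. indicator A (X \<omega>) \<partial>M)"
    by (rule integral_weight) simp
  also have "(\<integral>\<omega>. indicator A (X \<omega>) \<partial>M) = (\<integral>\<omega>. indicat_real (X -` A \<inter> space M) \<omega> \<partial>M)"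
    by (intro Bochner_Integration.integral_cong) (auto simp: indicator_def)
  finally show ?thesis by simp
qed

lemma censor_region_sets [measurable]: "censor_region (space \<nu>) t b \<in> sets \<nu>"
proof -
  have "(\<lambda>x. x) -` {..t} \<inter> space \<nu> \<in> sets \<nu>" "(\<lambda>x. x) -` {t<..} \<inter> space \<nu> \<in> sets \<nu>"
    by (rule measurable_sets[OF id_measurable]; simp)+
  moreover have "(\<lambda>x. x) -` {..t} \<inter> space \<nu> = {x \<in> space \<nu>. x \<le> t}"
    "(\<lambda>x. x) -` {t<..} \<inter> space \<nu> = {x \<in> space \<nu>. x > t}"
    by auto
  ultimately show ?thesis by (simp add: censor_region_def)
qed

lemma censored_measurable [measurable]: "(\<lambda>\<omega>. censor t (X \<omega>)) \<in> measurable M (count_space UNIV)"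
  by measurable

lemma censored_range: "(\<lambda>\<omega>. censor t (X \<omega>)) ` space M \<subseteq> {1, -1}"
  using censor_in by blast

text \<open>Near 0 the censored probability is a quotient of two unnormalized integrals, over the
  region and over the whole space. Positive probability of \<open>b\<close> keeps the logarithm
  differentiable.\<close>

lemma DERIV_censored_loglik:
  assumes b: "b \<in> {1, -1}" and pos: "0 < prob ((\<lambda>\<omega>. censor t (X \<omega>)) -` {b} \<inter> space M)"
  shows "((\<lambda>u. ln (censored_pmf \<nu> h T W t b (\<theta>0 + u *\<^sub>R axis r 1)))
    has_real_derivative censored_score M X T W t r b) (at 0)"
proof -
  let ?A = "censor_region (space \<nu>) t b" and ?v = "column r W"
  let ?E = "(\<lambda>\<omega>. censor t (X \<omega>)) -` {b} \<inter> space M"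
  define F where "F B u = (\<integral>x. indicator B x * (h x * exp ((W *v \<theta>0 + u *\<^sub>R ?v) \<bullet> T x)) \<partial>\<nu>)" for B u
  have X_space: "X \<omega> \<in> space \<nu>" if "\<omega> \<in> space M" for \<omega>
    using measurable_space[OF X_measurable that] .
  \<comment> \<open>The restriction on \<open>b\<close> matters: \<open>censor_region\<close> gives
    the upper region for every value other than 1, while \<open>censor\<close> takes only the value
    -1 there.\<close>
  have E: "X -` ?A \<inter> space M = ?E"
    using censor_eq_iff[OF b X_space] by auto
  have ind_A: "indicator ?A (X \<omega>) = (indicator ?E \<omega> :: real)" if "\<omega> \<in> space M" for \<omega>
    using censor_eq_iff[OF b X_space[OF that]] that by (simp add: indicator_def)
  have ind_space: "indicator (space \<nu>) (X \<omega>) = (1 :: real)" if "\<omega> \<in> space M" for \<omega>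
    using X_space[OF that] by simp
  have FA0: "F ?A 0 = normalizer * prob ?E"
    unfolding F_def by (subst region_at_zero) (auto simp: E)
  have F0: "F (space \<nu>) 0 = normalizer"
  proof -
    have "X -` space \<nu> \<inter> space M = space M" using X_space by auto
    then show ?thesis unfolding F_def by (subst region_at_zero) (auto simp: prob_space)
  qed
  have dA: "(F ?A has_real_derivative normalizer * (\<integral>\<omega>. indicator ?E \<omega> * (?v \<bullet> T (X \<omega>)) \<partial>M)) (at 0)"
    unfolding F_def using DERIV_region[OF censor_region_sets, of t b ?v]
    by (simp add: ind_A cong: Bochner_Integration.integral_cong)
  have d: "(F (space \<nu>) has_real_derivative normalizer * (\<integral>\<omega>. ?v \<bullet> T (X \<omega>) \<partial>M)) (at 0)"
    unfolding F_def using DERIV_region[OF sets.top, of ?v]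
    by (simp add: ind_space cong: Bochner_Integration.integral_cong)
  \<comment> \<open>The derivative is the difference of the two logarithmic derivatives;
    \<open>normalizer\<close> cancels in each of them.\<close>
  have ratio: "((\<lambda>u. ln (F ?A u / F (space \<nu>) u)) has_real_derivative censored_score M X T W t r b) (at 0)"
  proof -
    have "F ?A 0 > 0" "F (space \<nu>) 0 > 0"
      using normalizer_pos pos by (auto simp: FA0 F0)
    then show ?thesis
      using normalizer_pos pos
      by (auto intro!: derivative_eq_intros dA d simp: FA0 F0 censored_score_def atom_mean_def field_simps power2_eq_square)
  qed
  \<comment> \<open>By continuity the normalizing integral stays positive near 0, where
    \<open>exp\<close> undoes the logarithm in \<open>log_partition\<close>. Agreement near 0 is
    enough for the derivative.\<close>
  have ev: "\<forall>\<^sub>F u in nhds 0. ln (F ?A u / F (space \<nu>) u)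
      = ln (censored_pmf \<nu> h T W t b (\<theta>0 + u *\<^sub>R axis r 1))"
  proof -
    have "\<forall>\<^sub>F u in nhds 0. 0 < F (space \<nu>) u"
      using DERIV_isCont[OF d] normalizer_pos
        tendsto_at_iff_tendsto_nhds[of "F (space \<nu>)" 0]
      by (intro order_tendstoD(1)[of _ "F (space \<nu>) 0"]) (auto simp: isCont_def F0)
    then show ?thesis
    proof eventually_elim
      case (elim u)
      let ?\<eta> = "W *v \<theta>0 + u *\<^sub>R ?v"
      have \<eta>: "W *v (\<theta>0 + u *\<^sub>R axis r 1) = ?\<eta>"
        by (simp add: matrix_vector_right_distrib matrix_vector_mult_scaleR matrix_vector_mult_basis)
      have "F (space \<nu>) u = (\<integral>x. h x * exp (?\<eta> \<bullet> T x) \<partial>\<nu>)"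
        unfolding F_def by (intro Bochner_Integration.integral_cong) auto
      then have "exp (log_partition \<nu> h T ?\<eta>) = F (space \<nu>) u"
        using elim by (simp add: log_partition_def)
      then have "glm_density \<nu> h T W (\<theta>0 + u *\<^sub>R axis r 1) x = h x * exp (?\<eta> \<bullet> T x) / F (space \<nu>) u" for x
        by (simp add: glm_density_def \<eta> exp_diff)
      then show ?case
        by (simp add: censored_pmf_def set_lebesgue_integral_def F_def)
    qed
  qed
  show ?thesis
    by (rule iffD1[OF DERIV_cong_ev[OF refl ev refl] ratio])
qed

lemma integrable_score:
  "integrable M (\<lambda>\<omega>. censored_score M X T W t r (censor t (X \<omega>)))"
  "integrable M (\<lambda>\<omega>. censored_score M X T W t r (censor t (X \<omega>)) * censored_score M X T W t s (censor t (X \<omega>)))"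
  using integrable_finite_range[OF censored_measurable _ censored_range, of "censored_score M X T W t r"]
    integrable_finite_range[OF censored_measurable _ censored_range, of "\<lambda>z. censored_score M X T W t r z * censored_score M X T W t s z"]
  by simp_all

text \<open>The mean of the conditional means is the unconditional mean, which the score
  subtracts.\<close>

lemma expectation_score: "(\<integral>\<omega>. censored_score M X T W t r (censor t (X \<omega>)) \<partial>M) = 0"
proof -
  have int: "integrable M (\<lambda>\<omega>. column r W \<bullet> T (X \<omega>))"
    using integrable_direction[OF sets.top] .
  show ?thesis
    unfolding censored_score_def
    using expectation_atom_mean[OF censored_measurable _ censored_range int]
      integrable_finite_range[OF censored_measurable _ censored_range, of "atom_mean M (\<lambda>\<omega>. censor t (X \<omega>)) (\<lambda>\<omega>. column r W \<bullet> T (X \<omega>))"]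
    by (subst Bochner_Integration.integral_diff) (simp_all add: prob_space)
qed

text \<open>The score is linear in the centred conditional means \<open>D a\<close> of the
  coordinates of \<open>T\<close>, with the entries of column \<open>r\<close> of \<open>W\<close>
  as coefficients. The expected product of two scores is therefore the bilinear form of the
  covariance matrix in two columns of \<open>W\<close>.\<close>

lemma score_covariance:
  "(transpose W ** covariance_matrix M (vec_cond_exp_given M (\<lambda>\<omega>. T (X \<omega>)) (\<lambda>\<omega>. censor t (X \<omega>))) ** W) $ r $ s
    = (\<integral>\<omega>. censored_score M X T W t r (censor t (X \<omega>)) * censored_score M X T W t s (censor t (X \<omega>)) \<partial>M)"
proof -
  define Z where "Z = (\<lambda>\<omega>. censor t (X \<omega>))"
  define C where "C = vec_cond_exp_given M (\<lambda>\<omega>. T (X \<omega>)) Z"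
  define D where "D a z = atom_mean M Z (\<lambda>\<omega>. T (X \<omega>) $ a) z - (\<integral>\<omega>. T (X \<omega>) $ a \<partial>M)" for a z
  have Zm [measurable]: "Z \<in> measurable M (count_space UNIV)" and Zr: "Z ` space M \<subseteq> {1, -1}"
    using censored_measurable censored_range by (auto simp: Z_def)
  have intT: "integrable M (\<lambda>\<omega>. T (X \<omega>) $ a)" for a
    using integrable_direction[OF sets.top, of "axis a 1"] by (simp add: inner_axis')
  have C: "AE \<omega> in M. C \<omega> $ a = atom_mean M Z (\<lambda>\<omega>. T (X \<omega>) $ a) (Z \<omega>)" for a
    using real_cond_exp_eq_atom_mean[OF Zm _ Zr intT] by (simp add: C_def vec_cond_exp_given_def vec_cond_exp_def)
  have [measurable]: "(\<lambda>\<omega>. C \<omega> $ a) \<in> borel_measurable M" for a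
    by (simp add: C_def vec_cond_exp_given_def vec_cond_exp_def)
  \<comment> \<open>The mean subtracted in the covariance of \<open>C\<close> is thus that of
    \<open>T\<close> itself, so \<open>D\<close> is the centred version of \<open>C\<close> up to a
    null set.\<close>
  have "(\<integral>\<omega>. C \<omega> $ a \<partial>M) = (\<integral>\<omega>. T (X \<omega>) $ a \<partial>M)" for a
    using expectation_atom_mean[OF Zm _ Zr intT, of a] integral_cong_AE[OF _ _ C[of a]] by simp
  then have "covariance_matrix M C $ a $ b = (\<integral>\<omega>. D a (Z \<omega>) * D b (Z \<omega>) \<partial>M)" for a b
    using C[of a] C[of b] by (auto simp: covariance_matrix_def D_def intro!: integral_cong_AE)
  moreover have score: "censored_score M X T W t r z = (\<Sum>a\<in>UNIV. W $ a $ r * D a z)" for r z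
    using atom_mean_sum[OF Zm, of UNIV "\<lambda>a \<omega>. T (X \<omega>) $ a" "\<lambda>a. W $ a $ r" z] intT
    by (simp add: censored_score_def D_def inner_vec_def column_def right_diff_distrib sum_subtractf flip: Z_def)
  moreover have "(\<integral>\<omega>. (\<Sum>a\<in>UNIV. W $ a $ r * D a (Z \<omega>)) * (\<Sum>b\<in>UNIV. W $ b $ s * D b (Z \<omega>)) \<partial>M)
      = (\<Sum>a\<in>UNIV. \<Sum>b\<in>UNIV. W $ a $ r * W $ b $ s * (\<integral>\<omega>. D a (Z \<omega>) * D b (Z \<omega>) \<partial>M))"
  proof -
    have "integrable M (\<lambda>\<omega>. D a (Z \<omega>) * D b (Z \<omega>))" for a b
      using integrable_finite_range[OF Zm _ Zr, of "\<lambda>z. D a z * D b z"] by simp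
    then have "(\<integral>\<omega>. (\<Sum>a\<in>UNIV. \<Sum>b\<in>UNIV. W $ a $ r * W $ b $ s * (D a (Z \<omega>) * D b (Z \<omega>))) \<partial>M)
      = (\<Sum>a\<in>UNIV. \<Sum>b\<in>UNIV. W $ a $ r * W $ b $ s * (\<integral>\<omega>. D a (Z \<omega>) * D b (Z \<omega>) \<partial>M))"
      by (subst Bochner_Integration.integral_sum; simp)+
    then show ?thesis by (simp add: sum_product mult_ac)
  qed
  moreover have "(transpose W ** covariance_matrix M C ** W) $ r $ s
      = (\<Sum>a\<in>UNIV. \<Sum>b\<in>UNIV. W $ a $ r * W $ b $ s * covariance_matrix M C $ a $ b)"
    by (subst sum.swap) (simp add: matrix_matrix_mult_def transpose_def sum_distrib_right sum_distrib_left mult_ac)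
  ultimately show ?thesis by (simp flip: Z_def C_def) (simp add: Z_def)
qed

end

section \<open>Combining the independent observations\<close>

theorem proposition1:
  fixes M :: "'a measure" and X :: "nat \<Rightarrow> 'a \<Rightarrow> real" and n :: nat
    and \<X> :: "real set" and \<nu> :: "real measure"
    and h :: "real \<Rightarrow> real" and T :: "real \<Rightarrow> real^'d"
    and V :: "nat \<Rightarrow> real^'k^'d" and \<tau> :: "nat \<Rightarrow> real"
    and \<Theta> :: "(real^'k) set" and \<theta>0 :: "real^'k"
  assumes "sets \<nu> = sets (restrict_space borel \<X>)"
    and "h \<in> borel_measurable \<nu>" and "\<And>x. x \<in> \<X> \<Longrightarrow> h x > 0"
    and "T \<in> borel_measurable \<nu>"
    and "\<And>i \<theta>. i \<in> {1..n} \<Longrightarrow> \<theta> \<in> \<Theta> \<Longrightarrow> V i *v \<theta> \<in> natural_params \<nu> h T"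
    and "\<theta>0 \<in> \<Theta>"
    and "\<And>i. i \<in> {1..n} \<Longrightarrow> V i *v \<theta>0 \<in> interior (natural_params \<nu> h T)"
    and "prob_space M"
    and "prob_space.indep_vars M (\<lambda>i. borel) X {1..n}"
    and "\<And>i. i \<in> {1..n} \<Longrightarrow> distributed M \<nu> (X i) (\<lambda>x. ennreal (glm_density \<nu> h T (V i) \<theta>0 x))"
    and "\<And>i. i \<in> {1..n} \<Longrightarrow> \<tau> i \<in> interior (convex hull \<X>)"
  shows "fisher_information M
           (\<lambda>\<omega>. censored_loglik \<nu> h T V \<tau> n (\<lambda>i. censor (\<tau> i) (X i \<omega>))) \<theta>0 =
         (\<Sum>i=1..n. transpose (V i) **
            covariance_matrix M
              (vec_cond_exp_given M (\<lambda>\<omega>. T (X i \<omega>)) (\<lambda>\<omega>. censor (\<tau> i) (X i \<omega>))) ** V i)"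
proof -
  interpret prob_space M by fact
  have X_borel: "X i \<in> borel_measurable M" if "i \<in> {1..n}" for i
    using assms(9) that unfolding indep_vars_def by auto
  have space_nu: "space \<nu> = \<X>"
    using sets_eq_imp_space_eq[OF assms(1)] by (simp add: space_restrict_space)
  have id: "(\<lambda>x. x) \<in> measurable \<nu> borel"
    unfolding measurable_cong_sets[OF assms(1) refl] by (rule measurable_restrict_space1) simp
  have obs: "glm_observation M (X i) \<nu> h T (V i) \<theta>0" if "i \<in> {1..n}" for i
    by unfold_locales (use that assms X_borel id space_nu in auto)
  \<comment> \<open>The scores are written as functions of the uncensored value, so that
    independence of the \<open>X i\<close> applies to them directly.\<close>
  define S where "S r i x = censored_score M (X i) T (V i) (\<tau> i) r (censor (\<tau> i) x)" for r i x
  have S_borel: "S r i \<in> borel_measurable borel" for r i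
    unfolding S_def by (rule measurable_compose[OF censor_measurable]) simp
  \<comment> \<open>Regions of probability zero are not excluded by the hypotheses, so the score formula
    holds only almost surely.\<close>
  have "AE \<omega> in M. \<forall>i\<in>{1..n}.
      0 < prob ((\<lambda>\<omega>. censor (\<tau> i) (X i \<omega>)) -` {censor (\<tau> i) (X i \<omega>)} \<inter> space M)"
    using glm_observation.censored_measurable[OF obs] glm_observation.censored_range[OF obs]
    by (intro AE_finite_allI AE_atom_pos[where S = "{1, -1}"]) auto
  then have score: "AE \<omega> in M. \<forall>r.
      partial_deriv r (censored_loglik \<nu> h T V \<tau> n (\<lambda>i. censor (\<tau> i) (X i \<omega>))) \<theta>0 = (\<Sum>i=1..n. S r i (X i \<omega>))"
  proof eventually_elim
    case (elim \<omega>)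
    show ?case
    proof
      fix r
      have "((\<lambda>u. \<Sum>i=1..n. ln (censored_pmf \<nu> h T (V i) (\<tau> i) (censor (\<tau> i) (X i \<omega>)) (\<theta>0 + u *\<^sub>R axis r 1)))
          has_real_derivative (\<Sum>i=1..n. S r i (X i \<omega>))) (at 0)"
        unfolding S_def using elim censor_in
        by (intro DERIV_sum glm_observation.DERIV_censored_loglik[OF obs]) auto
      then show "partial_deriv r (censored_loglik \<nu> h T V \<tau> n (\<lambda>i. censor (\<tau> i) (X i \<omega>))) \<theta>0
          = (\<Sum>i=1..n. S r i (X i \<omega>))"
        by (simp add: partial_deriv_def censored_loglik_def DERIV_imp_deriv)
    qed
  qed
  define D where "D r z = partial_deriv r (censored_loglik \<nu> h T V \<tau> n z) \<theta>0" for r z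
  \<comment> \<open>The partial derivatives are measurable because they depend on the outcome only through
    the finitely many possible values of the censored data.\<close>
  define Z where "Z \<omega> = restrict (\<lambda>i. censor (\<tau> i) (X i \<omega>)) {1..n}" for \<omega>
  have fin: "finite ({1..n} \<rightarrow>\<^sub>E {1, -1 :: int})"
    by (rule finite_PiE) auto
  have "Z \<in> measurable M (count_space ({1..n} \<rightarrow>\<^sub>E {1, -1}))"
    unfolding measurable_count_space_eq2[OF fin]
  proof (intro conjI ballI)
    show "Z \<in> space M \<rightarrow> {1..n} \<rightarrow>\<^sub>E {1, -1}"
      using censor_in by (auto simp: Z_def)
    fix z :: "nat \<Rightarrow> int" assume "z \<in> {1..n} \<rightarrow>\<^sub>E {1, -1}"
    \<comment> \<open>Both \<open>Z \<omega>\<close> and \<open>z\<close> are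
      \<open>undefined\<close> outside \<open>{1..n}\<close>, so their equality is a matter of
      finitely many coordinates.\<close>
    then have "Z -` {z} \<inter> space M = {\<omega> \<in> space M. \<forall>i\<in>{1..n}. censor (\<tau> i) (X i \<omega>) = z i}"
      by (auto simp: Z_def PiE_def extensional_def fun_eq_iff)
    also have "\<dots> \<in> sets M"
    proof (rule sets.sets_Collect_finite_All)
      fix i assume "i \<in> {1..n}"
      note X_borel[OF this, measurable]
      show "{\<omega> \<in> space M. censor (\<tau> i) (X i \<omega>) = z i} \<in> sets M" by measurable
    qed simp
    finally show "Z -` {z} \<inter> space M \<in> sets M" .
  qed
  then have "(\<lambda>\<omega>. D r (Z \<omega>)) \<in> borel_measurable M" for r
    by (rule measurable_compose) simp
  \<comment> \<open>The log-likelihood reads the data at the indices \<open>{1..n}\<close> only, so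
    the restriction in \<open>Z\<close> does not change it.\<close>
  moreover have "D r (Z \<omega>) = D r (\<lambda>i. censor (\<tau> i) (X i \<omega>))" for r \<omega>
  proof -
    have "censored_loglik \<nu> h T V \<tau> n (Z \<omega>) = censored_loglik \<nu> h T V \<tau> n (\<lambda>i. censor (\<tau> i) (X i \<omega>))"
      by (auto simp: Z_def censored_loglik_def fun_eq_iff intro!: sum.cong)
    then show ?thesis by (simp add: D_def)
  qed
  ultimately have D_borel [measurable]:
    "(\<lambda>\<omega>. partial_deriv r (censored_loglik \<nu> h T V \<tau> n (\<lambda>i. censor (\<tau> i) (X i \<omega>))) \<theta>0) \<in> borel_measurable M" for r
    by (simp add: D_def)
  show ?thesis
    unfolding vec_eq_iff
  proof (intro allI)
    fix r s
    have "(\<integral>\<omega>. partial_deriv r (censored_loglik \<nu> h T V \<tau> n (\<lambda>i. censor (\<tau> i) (X i \<omega>))) \<theta>0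
          * partial_deriv s (censored_loglik \<nu> h T V \<tau> n (\<lambda>i. censor (\<tau> i) (X i \<omega>))) \<theta>0 \<partial>M)
        = (\<integral>\<omega>. (\<Sum>i=1..n. S r i (X i \<omega>)) * (\<Sum>i=1..n. S s i (X i \<omega>)) \<partial>M)"
    \<comment> \<open>Replacing the partial derivatives by the scores almost surely requires both
      integrands to be measurable; for the left one this is \<open>D_borel\<close>.\<close>
    proof (rule integral_cong_AE)
      have "(\<lambda>\<omega>. S r i (X i \<omega>)) \<in> borel_measurable M" if "i \<in> {1..n}" for r i
        using measurable_compose[OF X_borel[OF that] S_borel] .
      then show "(\<lambda>\<omega>. (\<Sum>i=1..n. S r i (X i \<omega>)) * (\<Sum>i=1..n. S s i (X i \<omega>))) \<in> borel_measurable M"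
        by (intro borel_measurable_times borel_measurable_sum)
      show "AE \<omega> in M. partial_deriv r (censored_loglik \<nu> h T V \<tau> n (\<lambda>i. censor (\<tau> i) (X i \<omega>))) \<theta>0
          * partial_deriv s (censored_loglik \<nu> h T V \<tau> n (\<lambda>i. censor (\<tau> i) (X i \<omega>))) \<theta>0
          = (\<Sum>i=1..n. S r i (X i \<omega>)) * (\<Sum>i=1..n. S s i (X i \<omega>))"
        using score by eventually_elim simp
    qed measurable
    \<comment> \<open>The mixed terms vanish since the scores are centred and independent.\<close>
    also have "\<dots> = (\<Sum>i=1..n. \<integral>\<omega>. S r i (X i \<omega>) * S s i (X i \<omega>) \<partial>M)"
      using glm_observation.integrable_score[OF obs] glm_observation.expectation_score[OF obs]
      by (intro expectation_sum_mult_sum_indep[OF _ assms(9)] S_borel) (auto simp: S_def)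
    also have "\<dots> = (\<Sum>i=1..n. (transpose (V i) ** covariance_matrix M
        (vec_cond_exp_given M (\<lambda>\<omega>. T (X i \<omega>)) (\<lambda>\<omega>. censor (\<tau> i) (X i \<omega>))) ** V i) $ r $ s)"
      unfolding S_def using glm_observation.score_covariance[OF obs] by simp
    finally show "fisher_information M
          (\<lambda>\<omega>. censored_loglik \<nu> h T V \<tau> n (\<lambda>i. censor (\<tau> i) (X i \<omega>))) \<theta>0 $ r $ s
        = (\<Sum>i=1..n. transpose (V i) ** covariance_matrix M
            (vec_cond_exp_given M (\<lambda>\<omega>. T (X i \<omega>)) (\<lambda>\<omega>. censor (\<tau> i) (X i \<omega>))) ** V i) $ r $ s"
      by (simp add: fisher_information_def)
  qed
qed

end
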